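(* Let $x$ be a quantum graph. Then $x\ge 0$ if and only if for every $\varepsilon>0$ there exist $k\ge1$ and $k$-labeled quantum graphs $y_1,\dots,y_m$ such that $\|x-y_1^2-\dots-y_m^2\|_1<\varepsilon$.
   Context: All graphs are finite and simple. A quantum graph is a formal finite real linear combination of graphs; throughout, graphs that become isomorphic after deleting their isolated nodes are identified, so a quantum graph is a finitely supported real vector $(\alpha_F)$ indexed by isomorphism classes of graphs without isolated nodes (including the empty graph), and $\|\sum_F\alpha_F F\|_1=\sum_F|\alpha_F|$. $\mathcal{W}_0$ is the set of symmetric measurable $W:[0,1]^2\to[0,1]$, and $t(F,W)=\int_{[0,1]^{V(F)}}\prod_{ij\in E(F)}W(x_i,x_j)\prod_{i\in V(F)}dx_i$ (this is unchanged by adding isolated nodes to $F$). For $x=\sum_i\alpha_iF_i$ we write $x\ge0$ if $\sum_i\alpha_it(F_i,W)\ge0$ for every $W\in\mathcal{W}_0$. A $k$-labeled graph is a graph in which $k$ nodes are labeled $1,\dots,k$ (other nodes unlabeled); for $k$-labeled graphs $F_1,F_2$, the product $F_1F_2$ is obtained from their disjoint union by identifying nodes with the same label (keeping a single copy of any multiple edge). A $k$-labeled quantum graph is a formal finite real linear combination of $k$-labeled graphs, and the product extends bilinearly. For a $k$-labeled quantum graph $y$, $y^2$ denotes the quantum graph obtained by computing $y\cdot y$ and then forgetting the labels. *)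

theory Defs
  imports "HOL-Analysis.Analysis"
begin

(* A graph modulo isolated nodes is represented by its edge set: a finite set of
   2-element subsets of nat. Its non-isolated nodes are the union of the edges. *)
type_synonym graph = "nat set set"

definition wf_graph :: "graph \<Rightarrow> bool" where
  "wf_graph E \<longleftrightarrow> finite E \<and> (\<forall>e\<in>E. card e = 2)"

definition giso :: "graph \<Rightarrow> graph \<Rightarrow> bool" where
  "giso E1 E2 \<longleftrightarrow> (\<exists>f. bij_betw f (\<Union>E1) (\<Union>E2) \<and> (\<lambda>e. f ` e) ` E1 = E2)"

(* quantum graph: formal finite real linear combination, as a list of (coefficient, graph) *)
type_synonym qgraph = "(real \<times> graph) list"

definition wf_qgraph :: "qgraph \<Rightarrow> bool" where
  "wf_qgraph x \<longleftrightarrow> (\<forall>p\<in>set x. wf_graph (snd p))"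

definition qclasses :: "qgraph \<Rightarrow> graph set set" where
  "qclasses x = (\<lambda>p. {E. giso E (snd p)}) ` set x"

definition qcoef :: "qgraph \<Rightarrow> graph set \<Rightarrow> real" where
  "qcoef x C = sum_list (map fst (filter (\<lambda>p. snd p \<in> C) x))"

definition qnorm1 :: "qgraph \<Rightarrow> real" where
  "qnorm1 x = (\<Sum>C\<in>qclasses x. \<bar>qcoef x C\<bar>)"

definition qminus :: "qgraph \<Rightarrow> qgraph \<Rightarrow> qgraph" where
  "qminus x y = x @ map (\<lambda>p. (- fst p, snd p)) y"

definition graphon :: "(real \<Rightarrow> real \<Rightarrow> real) \<Rightarrow> bool" where
  "graphon W \<longleftrightarrow> (\<forall>x y. W x y = W y x) \<and> (\<forall>x y. 0 \<le> W x y \<and> W x y \<le> 1)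
     \<and> case_prod W \<in> borel_measurable borel"

definition tdens :: "graph \<Rightarrow> (real \<Rightarrow> real \<Rightarrow> real) \<Rightarrow> real" where
  "tdens E W = (LINT x | PiM (\<Union>E) (\<lambda>_. restrict_space lborel {0..1}).
        (\<Prod>e\<in>E. W (x (Min e)) (x (Max e))))"

definition qeval :: "qgraph \<Rightarrow> (real \<Rightarrow> real \<Rightarrow> real) \<Rightarrow> real" where
  "qeval x W = (\<Sum>p\<leftarrow>x. fst p * tdens (snd p) W)"

definition qnonneg :: "qgraph \<Rightarrow> bool" where
  "qnonneg x \<longleftrightarrow> (\<forall>W. graphon W \<longrightarrow> qeval x W \<ge> 0)"

(* k-labeled graphs: edge set on nat, vertex i (i < k) carries label i+1, vertices \<ge> k
   are unlabeled. Product: disjoint union of the unlabeled parts, labels identified,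
   duplicate edges merged (set union). *)
definition lab_shift :: "nat \<Rightarrow> nat \<Rightarrow> nat \<Rightarrow> nat" where
  "lab_shift k b v = (if v < k then v else k + 2 * (v - k) + b)"

definition lprod :: "nat \<Rightarrow> graph \<Rightarrow> graph \<Rightarrow> graph" where
  "lprod k F G = (\<lambda>e. lab_shift k 0 ` e) ` F \<union> (\<lambda>e. lab_shift k 1 ` e) ` G"

(* y^2 for a k-labeled quantum graph y, with labels forgotten *)
definition lsq :: "nat \<Rightarrow> qgraph \<Rightarrow> qgraph" where
  "lsq k y = concat (map (\<lambda>p. map (\<lambda>q. (fst p * fst q, lprod k (snd p) (snd q))) y) y)"

end

theory Submission
  imports Defs "HOL-Probability.Probability"
begin

text \<open>
  In the algebra of fully labeled graphs on \<open>n\<close> nodes, the elements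
  \<open>e\<^sub>G = \<Sum>{(-1)\<^bsup>|S - G|\<^esup> S | G \<subseteq> S}\<close> are orthogonal idempotents with sum \<open>1\<close>, and
  \<open>F = \<Sum>{e\<^sub>G | F \<subseteq> G}\<close>. Averaging over all injections of the nodes of \<open>F\<close> into \<open>n\<close> labels
  gives, after forgetting labels, \<open>x = \<Sum>\<^sub>G t\<^sub>i\<^sub>n\<^sub>j(x, G) e\<^sub>G\<close> for every quantum graph \<open>x\<close> and
  all large \<open>n\<close>.

  Injective and ordinary homomorphism densities differ by \<open>o(1)\<close> uniformly in \<open>G\<close>. If \<open>x \<ge> 0\<close>,
  then evaluating \<open>x\<close> at the step graphon of \<open>G\<close> shows \<open>t\<^sub>i\<^sub>n\<^sub>j(x, G) \<ge> -\<delta>\<close>, hence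
  \<open>x + \<delta> = \<Sum>\<^sub>G (t\<^sub>i\<^sub>n\<^sub>j(x, G) + \<delta>) e\<^sub>G\<close> is a sum of squares. Conversely \<open>t(e\<^sub>G, W)\<close> is the
  integral of the nonnegative function \<open>\<Prod>\<^sub>e\<^sub>\<in>\<^sub>G W\<^sub>e \<Prod>\<^sub>e\<^sub>\<notin>\<^sub>G (1 - W\<^sub>e)\<close>, and the homomorphism density
  of \<open>y\<^sup>2\<close> in a finite graph is a sum of squares over the images of the labeled nodes (merging
  multiple edges is harmless for a 0-1 valued adjacency matrix), so \<open>t(y\<^sup>2, W) \<ge> 0\<close>.
\<close>

section \<open>Moebius inversion on intervals of sets\<close>

text \<open>The value at the idempotent \<open>e\<^sub>G\<close> of the linear extension of
  \<open>f\<close>: the Moebius transform towards supersets in the Boolean lattice of subsets of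
  \<open>P\<close>.\<close>

definition mobius :: "'a set \<Rightarrow> ('a set \<Rightarrow> real) \<Rightarrow> 'a set \<Rightarrow> real" where
  "mobius P f G = (\<Sum>S\<in>{G..P}. (-1) ^ card (S - G) * f S)"

lemma finite_set_interval: "finite K \<Longrightarrow> finite {G..K :: 'a set}"
  by (rule finite_subset[of _ "Pow K"]) auto

lemma sum_set_interval_diff:
  assumes "G \<subseteq> K"
  shows "(\<Sum>S\<in>{G..K}. g S) = (\<Sum>X\<in>Pow (K - G). g (G \<union> X))"
  by (rule sum.reindex_bij_witness[of _ "\<lambda>X. G \<union> X" "\<lambda>S. S - G"])
     (use assms in \<open>auto simp: Un_absorb1\<close>)

text \<open>Expansion of the product of the factors \<open>1 - u e\<close>. It serves twice: with
  \<open>u = 1\<close> for alternating sums, and with edge values of a graphon for the sign of its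
  density at \<open>e\<^sub>G\<close>.\<close>

lemma sum_prod_set_interval:
  fixes u :: "'a \<Rightarrow> real"
  assumes "finite K" "G \<subseteq> K"
  shows "(\<Sum>S\<in>{G..K}. (-1) ^ card (S - G) * prod u S) = prod u G * (\<Prod>e\<in>K - G. 1 - u e)"
proof -
  have fin: "finite G" "finite (K - G)" using assms finite_subset by auto
  have "(\<Sum>S\<in>{G..K}. (-1) ^ card (S - G) * prod u S)
      = (\<Sum>X\<in>Pow (K - G). (-1) ^ card X * (prod u G * prod u X))"
    unfolding sum_set_interval_diff[OF assms(2)]
  proof (intro sum.cong refl)
    fix X assume X: "X \<in> Pow (K - G)"
    then have "G \<union> X - G = X" by auto
    moreover have "prod u (G \<union> X) = prod u G * prod u X"
      using X fin by (intro prod.union_disjoint) (auto dest: finite_subset)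
    ultimately show "(-1) ^ card (G \<union> X - G) * prod u (G \<union> X) = (-1) ^ card X * (prod u G * prod u X)"
      by simp
  qed
  also have "\<dots> = prod u G * (\<Sum>X\<in>Pow (K - G). (-1) ^ card X * prod u X * (\<Prod>e\<in>(K-G)-X. 1))"
    by (simp add: sum_distrib_left algebra_simps)
  also have "\<dots> = prod u G * (\<Prod>e\<in>K - G. 1 - u e)"
    using prod_diff_conv_sum[OF fin(2), of "\<lambda>_. 1" u] by simp
  finally show ?thesis .
qed

lemma alternating_sum_set_interval:
  assumes "finite K"
  shows "(\<Sum>S\<in>{G..K}. (-1) ^ card (S - G)) = (of_bool (G = K) :: real)"
proof (cases "G \<subseteq> K")
  case True
  \<comment> \<open>A product of factors \<open>1 - 1\<close>, which is nonzero only when it is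
    empty.\<close>
  have "(\<Sum>S\<in>{G..K}. (-1) ^ card (S - G)) = (\<Prod>e\<in>K - G. 0 :: real)"
    using sum_prod_set_interval[OF assms True, of "\<lambda>_. 1"] by simp
  also have "\<dots> = of_bool (G = K)"
    using assms True by (cases "K - G = {}") (auto simp: prod_zero_iff)
  finally show ?thesis .
qed auto

lemma alternating_sum_set_interval':
  assumes "finite K"
  shows "(\<Sum>S\<in>{G..K}. (-1) ^ card (K - S)) = (of_bool (G = K) :: real)"
proof (cases "G \<subseteq> K")
  case True
  \<comment> \<open>Complementation inside the interval exchanges distance from \<open>G\<close>
    with distance to \<open>K\<close>.\<close>
  have "(\<Sum>S\<in>{G..K}. (-1) ^ card (K - S) :: real) = (\<Sum>S\<in>{G..K}. (-1) ^ card (S - G))"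
    by (rule sum.reindex_bij_witness[of _ "\<lambda>S. G \<union> (K - S)" "\<lambda>S. G \<union> (K - S)"])
       (use True in \<open>auto intro!: arg_cong[where f = "\<lambda>A. (-1) ^ card A"]\<close>)
  then show ?thesis by (simp add: alternating_sum_set_interval[OF assms])
qed auto

text \<open>The expansion of a graph \<open>H\<close> into the idempotents above it. After
  exchanging the sums, the alternating sum over each interval \<open>{H..S}\<close> kills every term
  except \<open>S = H\<close>.\<close>

lemma mobius_inversion:
  assumes "finite P" "H \<subseteq> P"
  shows "(\<Sum>G\<in>{H..P}. mobius P f G) = f H"
proof -
  have "(\<Sum>G\<in>{H..P}. mobius P f G) = (\<Sum>G\<in>{H..P}. \<Sum>S\<in>{S\<in>{H..P}. G \<subseteq> S}. (-1) ^ card (S - G) * f S)"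
    unfolding mobius_def by (intro sum.cong) force+
  also have "\<dots> = (\<Sum>S\<in>{H..P}. \<Sum>G\<in>{G\<in>{H..P}. G \<subseteq> S}. (-1) ^ card (S - G) * f S)"
    by (rule sum.swap_restrict) (simp_all add: finite_set_interval assms)
  also have "\<dots> = (\<Sum>S\<in>{H..P}. (\<Sum>G\<in>{H..S}. (-1) ^ card (S - G)) * f S)"
    unfolding sum_distrib_right by (intro sum.cong) force+
  also have "\<dots> = (\<Sum>S\<in>{H..P}. if S = H then f S else 0)"
  proof (intro sum.cong refl)
    fix S assume "S \<in> {H..P}"
    then have "finite S" using assms finite_subset by auto
    then show "(\<Sum>G\<in>{H..S}. (-1) ^ card (S - G)) * f S = (if S = H then f S else 0)"
      by (auto simp: alternating_sum_set_interval')
  qed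
  also have "\<dots> = f H" using assms by (simp add: sum.delta' finite_set_interval)
  finally show ?thesis .
qed

text \<open>The identity \<open>e\<^sub>G e\<^sub>G = e\<^sub>G\<close> as seen by \<open>f\<close>,
  the product of fully labeled graphs being the union. Inversion writes
  \<open>f (S \<union> T)\<close> as a sum over \<open>K\<close>; the condition
  \<open>S \<union> T \<subseteq> K\<close> splits into one on \<open>S\<close> and one on
  \<open>T\<close>, so the sum factors into two alternating sums, each nonzero only for
  \<open>K = G\<close>.\<close>

lemma mobius_idempotent:
  assumes "finite P" "G \<subseteq> P"
  shows "(\<Sum>S\<in>{G..P}. \<Sum>T\<in>{G..P}. (-1) ^ card (S - G) * (-1) ^ card (T - G) * f (S \<union> T)) = mobius P f G"
proof -
  note [simp] = finite_set_interval[OF assms(1)]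
  define c :: "'a set \<Rightarrow> real" where "c = (\<lambda>S. (-1) ^ card (S - G))"
  have "(\<Sum>S\<in>{G..P}. \<Sum>T\<in>{G..P}. c S * c T * f (S \<union> T))
      = (\<Sum>S\<in>{G..P}. \<Sum>T\<in>{G..P}. \<Sum>K\<in>{G..P}. c S * c T * (of_bool (S \<subseteq> K) * of_bool (T \<subseteq> K) * mobius P f K))"
  proof (intro sum.cong refl)
    fix S T assume ST: "S \<in> {G..P}" "T \<in> {G..P}"
    then have "f (S \<union> T) = (\<Sum>K\<in>{S \<union> T..P}. mobius P f K)"
      using mobius_inversion[OF assms(1), of "S \<union> T"] by auto
    also have "\<dots> = (\<Sum>K\<in>{G..P}. of_bool (S \<subseteq> K) * of_bool (T \<subseteq> K) * mobius P f K)"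
      using ST by (intro sum.mono_neutral_cong_left) auto
    finally show "c S * c T * f (S \<union> T)
       = (\<Sum>K\<in>{G..P}. c S * c T * (of_bool (S \<subseteq> K) * of_bool (T \<subseteq> K) * mobius P f K))"
      by (simp add: sum_distrib_left)
  qed
  also have "\<dots> = (\<Sum>S\<in>{G..P}. \<Sum>K\<in>{G..P}. \<Sum>T\<in>{G..P}. c S * c T * (of_bool (S \<subseteq> K) * of_bool (T \<subseteq> K) * mobius P f K))"
    by (intro sum.cong refl sum.swap)
  also have "\<dots> = (\<Sum>K\<in>{G..P}. \<Sum>S\<in>{G..P}. \<Sum>T\<in>{G..P}. c S * c T * (of_bool (S \<subseteq> K) * of_bool (T \<subseteq> K) * mobius P f K))"
    by (rule sum.swap)
  also have "\<dots> = (\<Sum>K\<in>{G..P}. (\<Sum>S\<in>{G..P}. c S * of_bool (S \<subseteq> K)) * (\<Sum>T\<in>{G..P}. c T * of_bool (T \<subseteq> K)) * mobius P f K)"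
    unfolding sum_product sum_distrib_right by (intro sum.cong refl) (simp only: mult_ac sum_distrib_left)
  also have "\<dots> = (\<Sum>K\<in>{G..P}. if K = G then mobius P f K else 0)"
  proof (intro sum.cong refl)
    fix K assume K: "K \<in> {G..P}"
    then have "finite K" using assms finite_subset by auto
    have "(\<Sum>S\<in>{G..P}. c S * of_bool (S \<subseteq> K)) = (\<Sum>S\<in>{G..K}. c S)"
      using K by (intro sum.mono_neutral_cong_right) auto
    also have "\<dots> = of_bool (G = K)"
      unfolding c_def by (rule alternating_sum_set_interval) fact
    finally show "(\<Sum>S\<in>{G..P}. c S * of_bool (S \<subseteq> K)) * (\<Sum>T\<in>{G..P}. c T * of_bool (T \<subseteq> K)) * mobius P f K
       = (if K = G then mobius P f K else 0)" by auto
  qed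
  also have "\<dots> = mobius P f G" using assms by (simp add: sum.delta')
  finally show ?thesis by (simp add: c_def)
qed

section \<open>Quantum graphs and isomorphism-invariant parameters\<close>

text \<open>Linear extension of a graph parameter. Evaluation at a graphon and the coefficient of a
  class are both instances, so identities between quantum graphs are expressed by testing them on
  parameters \<open>f\<close>.\<close>

definition qsum :: "(graph \<Rightarrow> real) \<Rightarrow> qgraph \<Rightarrow> real" where
  "qsum f x = (\<Sum>p\<leftarrow>x. fst p * f (snd p))"

lemma qsum_simps [simp]:
  "qsum f [] = 0" "qsum f (p # x) = fst p * f (snd p) + qsum f x" "qsum f (x @ y) = qsum f x + qsum f y"
  by (simp_all add: qsum_def)

lemma qsum_concat: "qsum f (concat ys) = (\<Sum>y\<leftarrow>ys. qsum f y)"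
  by (induction ys) simp_all

lemma qsum_map_scale: "qsum f (map (\<lambda>p. (c * fst p, g (snd p))) x) = c * qsum (\<lambda>F. f (g F)) x"
  by (induction x) (simp_all add: algebra_simps)

lemma qsum_qminus: "qsum f (qminus x y) = qsum f x - qsum f y"
  using qsum_map_scale[of f "-1" "\<lambda>F. F" y] by (simp add: qminus_def)

lemma qsum_lsq: "qsum f (lsq k y) = qsum (\<lambda>F. qsum (\<lambda>H. f (lprod k F H)) y) y"
proof -
  \<comment> \<open>The outer copy of \<open>y\<close> is generalized to \<open>z\<close>, so that
    the induction leaves the inner copy fixed.\<close>
  have "qsum f (concat (map (\<lambda>p. map (\<lambda>q. (fst p * fst q, lprod k (snd p) (snd q))) y) z))
      = qsum (\<lambda>F. qsum (\<lambda>H. f (lprod k F H)) y) z" for z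
    by (induction z) (simp_all add: qsum_map_scale)
  then show ?thesis by (simp add: lsq_def)
qed

lemma qsum_cong: "(\<And>p. p \<in> set x \<Longrightarrow> f (snd p) = g (snd p)) \<Longrightarrow> qsum f x = qsum g x"
  by (induction x) simp_all

lemma qsum_sum: "qsum (\<lambda>F. \<Sum>i\<in>A. g i F) x = (\<Sum>i\<in>A. qsum (g i) x)"
  by (induction x) (simp_all add: sum.distrib sum_distrib_left)

lemma qsum_scale: "qsum (\<lambda>F. c * f F) x = c * qsum f x"
  by (induction x) (simp_all add: algebra_simps)

lemma qsum_map_signed_set:
  assumes "distinct L"
  shows "qsum f (map (\<lambda>S. (c S, S)) L) = (\<Sum>S\<in>set L. c S * f S)"
  using assms by (induction L) simp_all

lemma qeval_eq_qsum: "qeval x W = qsum (\<lambda>F. tdens F W) x"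
  by (simp add: qeval_def qsum_def)

lemma qcoef_eq_qsum: "qcoef x C = qsum (\<lambda>F. of_bool (F \<in> C)) x"
  by (induction x) (simp_all add: qcoef_def)

section \<open>Isomorphism classes and invariant parameters\<close>

lemma giso_refl: "giso E E"
  unfolding giso_def by (intro exI[of _ id]) auto

lemma giso_sym:
  assumes "giso E F" shows "giso F E"
proof -
  obtain f where f: "bij_betw f (\<Union>E) (\<Union>F)" "(\<lambda>e. f ` e) ` E = F"
    using assms by (auto simp: giso_def)
  let ?g = "inv_into (\<Union>E) f"
  have "?g ` (f ` e) = e" if "e \<in> E" for e
    using f(1) that by (intro inv_into_image_cancel) (auto simp: bij_betw_def)
  then have "(\<lambda>e. ?g ` e) ` F = E"
    unfolding f(2)[symmetric] image_image by simp
  then show ?thesis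
    unfolding giso_def using bij_betw_inv_into[OF f(1)] by blast
qed

lemma giso_trans:
  assumes "giso E F" "giso F H" shows "giso E H"
proof -
  obtain f where f: "bij_betw f (\<Union>E) (\<Union>F)" "(\<lambda>e. f ` e) ` E = F"
    using assms by (auto simp: giso_def)
  obtain g where g: "bij_betw g (\<Union>F) (\<Union>H)" "(\<lambda>e. g ` e) ` F = H"
    using assms by (auto simp: giso_def)
  have "(\<lambda>e. (g \<circ> f) ` e) ` E = H"
    unfolding g(2)[symmetric] f(2)[symmetric] by (simp add: image_image image_comp)
  then show ?thesis
    unfolding giso_def using bij_betw_trans[OF f(1) g(1)] by blast
qed

lemma giso_image: "inj_on f (\<Union>F) \<Longrightarrow> giso F ((\<lambda>e. f ` e) ` F)"
  unfolding giso_def by (intro exI[of _ f]) (auto simp: bij_betw_def)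

lemma wf_graph_image:
  assumes "wf_graph F" "inj_on f (\<Union>F)"
  shows "wf_graph ((\<lambda>e. f ` e) ` F)"
  using assms unfolding wf_graph_def
  by (auto intro!: card_image[THEN trans] intro: inj_on_subset)

lemma finite_Union_wf_graph: "wf_graph F \<Longrightarrow> finite (\<Union>F)"
  unfolding wf_graph_def by (metis card.infinite finite_Union zero_neq_numeral)

text \<open>Well-formedness matters because \<open>tdens\<close> reads an edge only through
  \<open>Min\<close> and \<open>Max\<close>: with larger edges its value can depend on the names of
  the nodes.\<close>

definition iso_inv :: "(graph \<Rightarrow> real) \<Rightarrow> bool" where
  "iso_inv f \<longleftrightarrow> (\<forall>E F. wf_graph E \<longrightarrow> giso E F \<longrightarrow> f E = f F)"

text \<open>Grouping by isomorphism class: the classes of an equivalence relation are disjoint, so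
  each graph of \<open>x\<close> is counted in one class, and \<open>f\<close> agrees on it and on
  the chosen representative.\<close>

lemma qsum_eq_sum_qclasses:
  assumes wf: "wf_qgraph x" and f: "iso_inv f"
  shows "qsum f x = (\<Sum>C\<in>qclasses x. qcoef x C * f (SOME F. F \<in> C))"
proof -
  have fin: "finite (qclasses x)" by (simp add: qclasses_def)
  have "qsum f x = qsum (\<lambda>F. \<Sum>C\<in>qclasses x. f (SOME F. F \<in> C) * of_bool (F \<in> C)) x"
  proof (rule qsum_cong)
    fix p assume p: "p \<in> set x"
    define C0 where "C0 = {E. giso E (snd p)}"
    have C0: "C0 \<in> qclasses x" using p by (auto simp: qclasses_def C0_def)
    have "snd p \<in> C \<longleftrightarrow> C = C0" if "C \<in> qclasses x" for C
      using that giso_trans giso_sym giso_refl unfolding qclasses_def C0_def by blast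
    then have "(\<Sum>C\<in>qclasses x. f (SOME F. F \<in> C) * of_bool (snd p \<in> C))
      = (\<Sum>C\<in>qclasses x. if C = C0 then f (SOME F. F \<in> C) else 0)"
      by (intro sum.cong) auto
    also have "\<dots> = f (SOME F. F \<in> C0)" using C0 fin by simp
    also have "(SOME F. F \<in> C0) \<in> C0"
      by (rule someI[of _ "snd p"]) (simp add: C0_def giso_refl)
    then have "giso (snd p) (SOME F. F \<in> C0)" unfolding C0_def using giso_sym by blast
    then have "f (SOME F. F \<in> C0) = f (snd p)"
      using f wf p unfolding iso_inv_def wf_qgraph_def by metis
    finally show "f (snd p) = (\<Sum>C\<in>qclasses x. f (SOME F. F \<in> C) * of_bool (snd p \<in> C))" by simp
  qed
  then show ?thesis by (simp add: qsum_sum qsum_scale qcoef_eq_qsum mult.commute[of _ "f _"])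
qed

lemma abs_qsum_le_qnorm1:
  assumes wf: "wf_qgraph x" and f: "iso_inv f" and b: "\<And>F. \<bar>f F\<bar> \<le> 1"
  shows "\<bar>qsum f x\<bar> \<le> qnorm1 x"
  unfolding qsum_eq_sum_qclasses[OF wf f] qnorm1_def
proof (intro order_trans[OF sum_abs] sum_mono)
  fix C
  show "\<bar>qcoef x C * f (SOME F. F \<in> C)\<bar> \<le> \<bar>qcoef x C\<bar>"
    using mult_left_mono[OF b abs_ge_zero] by (simp add: abs_mult)
qed

section \<open>Homomorphism densities in finite graphs\<close>

definition all_pairs :: "nat \<Rightarrow> graph" where
  "all_pairs n = {e. e \<subseteq> {..<n} \<and> card e = 2}"

lemma finite_all_pairs: "finite (all_pairs n)"
  by (rule finite_subset[of _ "Pow {..<n}"]) (auto simp: all_pairs_def)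

lemma wf_graph_subset_all_pairs: "S \<subseteq> all_pairs n \<Longrightarrow> wf_graph S"
  unfolding wf_graph_def using finite_subset[OF _ finite_all_pairs] by (auto simp: all_pairs_def)

definition inj_maps :: "nat set \<Rightarrow> nat \<Rightarrow> (nat \<Rightarrow> nat) set" where
  "inj_maps V n = {\<phi> \<in> V \<rightarrow>\<^sub>E {..<n}. inj_on \<phi> V}"

text \<open>\<open>V\<close> is separate from the nodes of \<open>F\<close>, so that graphs can be
  counted together with isolated nodes.\<close>

definition hom_maps :: "nat set \<Rightarrow> graph \<Rightarrow> nat \<Rightarrow> graph \<Rightarrow> (nat \<Rightarrow> nat) set" where
  "hom_maps V F n G = {\<phi> \<in> V \<rightarrow>\<^sub>E {..<n}. \<forall>e\<in>F. \<phi> ` e \<in> G}"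

definition tinj :: "nat \<Rightarrow> graph \<Rightarrow> graph \<Rightarrow> real" where
  "tinj n G F = card (inj_maps (\<Union>F) n \<inter> hom_maps (\<Union>F) F n G) / card (inj_maps (\<Union>F) n)"

definition thom :: "nat \<Rightarrow> graph \<Rightarrow> graph \<Rightarrow> real" where
  "thom n G F = card (hom_maps (\<Union>F) F n G) / n ^ card (\<Union>F)"

lemma finite_inj_maps: "finite V \<Longrightarrow> finite (inj_maps V n)"
  unfolding inj_maps_def by (simp add: finite_PiE)

lemma finite_hom_maps: "finite V \<Longrightarrow> finite (hom_maps V F n G)"
  unfolding hom_maps_def by (simp add: finite_PiE)

lemma card_inj_maps: "finite V \<Longrightarrow> card (inj_maps V n) = (\<Prod>i<card V. n - i)"
  unfolding inj_maps_def using card_inj_on_subset_funcset[of V "{..<n}" V]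
  by (simp add: atLeast0LessThan)

text \<open>Each injection \<open>\<phi>\<close> gives an isomorphic copy of \<open>F\<close> on
  \<open>{..<n}\<close>, so \<open>f F\<close> is the sum of the transforms at all \<open>G\<close>
  containing that copy, that is, all \<open>G\<close> into which \<open>\<phi>\<close> is a
  homomorphism. Averaging over \<open>\<phi>\<close> turns this condition into
  \<open>tinj n G F\<close>.\<close>

lemma iso_inv_eq_sum_tinj:
  assumes f: "iso_inv f" and F: "wf_graph F" and n: "card (\<Union>F) \<le> n"
  shows "f F = (\<Sum>G\<in>Pow (all_pairs n). tinj n G F * mobius (all_pairs n) f G)"
proof -
  note fV = finite_Union_wf_graph[OF F]
  note fP = finite_all_pairs[of n]
  let ?I = "inj_maps (\<Union>F) n" and ?m = "mobius (all_pairs n) f"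
  have pos: "card ?I > 0" using fV n by (auto simp: card_inj_maps intro!: prod_pos)
  have "card ?I * f F = (\<Sum>\<phi>\<in>?I. \<Sum>G\<in>Pow (all_pairs n). of_bool (\<phi> \<in> hom_maps (\<Union>F) F n G) * ?m G)"
  proof -
    have "f F = (\<Sum>G\<in>Pow (all_pairs n). of_bool (\<phi> \<in> hom_maps (\<Union>F) F n G) * ?m G)" if \<phi>: "\<phi> \<in> ?I" for \<phi>
    proof -
      let ?H = "(\<lambda>e. \<phi> ` e) ` F"
      have inj: "inj_on \<phi> (\<Union>F)" and mp: "\<phi> \<in> \<Union>F \<rightarrow>\<^sub>E {..<n}" using \<phi> by (auto simp: inj_maps_def)
      have "?H \<subseteq> all_pairs n"
        using wf_graph_image[OF F inj] mp unfolding all_pairs_def wf_graph_def by fastforce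
      then have "f ?H = (\<Sum>G\<in>{?H..all_pairs n}. ?m G)"
        using mobius_inversion[OF fP] by metis
      also have "\<dots> = (\<Sum>G\<in>Pow (all_pairs n). of_bool (\<phi> \<in> hom_maps (\<Union>F) F n G) * ?m G)"
        using mp by (intro sum.mono_neutral_cong_left) (auto simp: hom_maps_def fP)
      finally show ?thesis using f F giso_image[OF inj] unfolding iso_inv_def by metis
    qed
    then show ?thesis by (simp flip: sum_constant)
  qed
  also have "\<dots> = (\<Sum>G\<in>Pow (all_pairs n). card (?I \<inter> hom_maps (\<Union>F) F n G) * ?m G)"
    by (subst sum.swap) (simp add: finite_inj_maps[OF fV] flip: sum_distrib_right)
  finally show ?thesis using pos
    by (simp add: tinj_def field_simps flip: sum_divide_distrib)
qed

text \<open>The product is the fraction of maps that are injective; restricting to them changes the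
  density by at most the fraction of the others, whatever \<open>G\<close> is.\<close>

lemma abs_tinj_thom_le:
  assumes "finite (\<Union>F)" "card (\<Union>F) \<le> n" "n \<ge> 1"
  shows "\<bar>tinj n G F - thom n G F\<bar> \<le> 1 - (\<Prod>i<card (\<Union>F). 1 - real i / real n)"
proof -
  let ?V = "\<Union>F"
  let ?A = "?V \<rightarrow>\<^sub>E {..<n}" and ?I = "inj_maps ?V n" and ?H = "hom_maps ?V F n G"
  have fA: "finite ?A" using assms by (simp add: finite_PiE)
  have sub: "?I \<subseteq> ?A" "?H \<subseteq> ?A" by (auto simp: inj_maps_def hom_maps_def)
  note fin = finite_subset[OF sub(1) fA] finite_subset[OF sub(2) fA]
  define N I a b where "N = real (card ?A)" and "I = real (card ?I)"
    and "a = real (card (?I \<inter> ?H))" and "b = real (card (?H - ?I))"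
  have N: "N = real n ^ card ?V" using assms by (simp add: N_def card_PiE)
  have Np: "N > 0" using assms by (simp add: N)
  have Ip: "I > 0" unfolding I_def using assms by (auto simp: card_inj_maps intro!: prod_pos)
  have "card (?H - ?I) \<le> card (?A - ?I)" using sub fA by (intro card_mono) auto
  then have b: "b \<le> N - I" unfolding b_def N_def I_def
    using card_Diff_subset[OF fin(1) sub(1)] card_mono[OF fA sub(1)] by simp
  have "card ?H = card (?I \<inter> ?H) + card (?H - ?I)"
    using card_Int_Diff[OF fin(2), of ?I] by (simp add: Int_commute)
  then have h: "thom n G F = (a + b) / N" unfolding thom_def a_def b_def N by simp
  have t: "tinj n G F = a / I" by (simp add: tinj_def a_def I_def)
  have a: "a \<le> I" "a \<ge> 0" "b \<ge> 0" "I \<le> N"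
    unfolding a_def I_def b_def N_def using fin fA sub by (auto intro!: card_mono)
  have "(\<Prod>i<card ?V. 1 - real i / real n) = (\<Prod>i<card ?V. real (n - i) / real n)"
    using assms by (intro prod.cong refl) (auto simp: field_simps of_nat_diff)
  also have "\<dots> = I / N" unfolding I_def N using assms by (simp add: card_inj_maps prod_dividef)
  finally have P: "(\<Prod>i<card ?V. 1 - real i / real n) = I / N" .
  \<comment> \<open>Over the common denominator \<open>I * N\<close> the difference of the densities
    has numerator \<open>a * (N - I) - b * I\<close>. Both terms lie between \<open>0\<close> and
    \<open>I * (N - I)\<close>, hence so does the absolute value of their difference.\<close>
  have "a * (N - I) \<le> I * (N - I)" using a by (intro mult_right_mono) auto
  moreover have "a * (N - I) \<ge> 0" using a by auto
  moreover have "b * I \<le> (N - I) * I" "b * I \<ge> 0" using b a by (auto intro!: mult_right_mono)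
  moreover have "a / I - (a + b) / N = (a * (N - I) - b * I) / (I * N)"
    using Ip Np by (simp add: field_simps)
  ultimately have "\<bar>a / I - (a + b) / N\<bar> = \<bar>a * (N - I) - b * I\<bar> / (I * N)"
    and "\<bar>a * (N - I) - b * I\<bar> \<le> I * (N - I)"
    using Ip Np by (simp add: abs_mult, simp only: mult.commute[of I] abs_le_iff, linarith)
  then have "\<bar>a / I - (a + b) / N\<bar> \<le> I * (N - I) / (I * N)"
    using Ip Np by (simp only: divide_right_mono mult_nonneg_nonneg less_imp_le)
  also have "\<dots> = 1 - I / N" using Ip Np by (simp add: field_simps)
  finally show ?thesis by (simp add: P h t)
qed

lemma eventually_tinj_thom_close:
  assumes "finite (\<Union>F)" "\<delta> > 0"
  shows "\<forall>\<^sub>F n in sequentially. \<forall>G. \<bar>tinj n G F - thom n G F\<bar> < \<delta>"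
proof -
  have "(\<lambda>n. 1 - (\<Prod>i<card (\<Union>F). 1 - real i / real n)) \<longlonglongrightarrow> 1 - (\<Prod>i<card (\<Union>F). 1 - 0)"
    by (intro tendsto_intros lim_const_over_n)
  then have "\<forall>\<^sub>F n in sequentially. 1 - (\<Prod>i<card (\<Union>F). 1 - real i / real n) < \<delta>"
    using assms by (intro order_tendstoD) auto
  then show ?thesis
    using eventually_ge_at_top[of "max 1 (card (\<Union>F))"]
  proof eventually_elim
    case (elim n)
    then show ?case
      using abs_tinj_thom_le[OF assms(1), of n] by (auto intro: le_less_trans)
  qed
qed

lemma eventually_qsum_tinj_thom_close:
  assumes "wf_qgraph x" "\<delta> > 0"
  shows "\<forall>\<^sub>F n in sequentially. \<forall>G. \<bar>qsum (tinj n G) x - qsum (thom n G) x\<bar> < \<delta>"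
  using assms
proof (induction x arbitrary: \<delta>)
  case (Cons p x)
  \<comment> \<open>Half of \<open>\<delta>\<close> is left for the tail; the summand
    \<open>1\<close> covers a zero coefficient.\<close>
  define \<eta> where "\<eta> = \<delta> / 2 / (\<bar>fst p\<bar> + 1)"
  have \<eta>: "\<eta> > 0" "\<bar>fst p\<bar> * \<eta> \<le> \<delta> / 2" using Cons.prems by (auto simp: \<eta>_def field_simps)
  have "finite (\<Union>(snd p))" "wf_qgraph x"
    using Cons.prems by (auto simp: wf_qgraph_def intro: finite_Union_wf_graph)
  from Cons.IH[OF this(2) half_gt_zero[OF Cons.prems(2)]] eventually_tinj_thom_close[OF this(1) \<eta>(1)]
  show ?case
  proof (eventually_elim)
    case (elim n)
    show ?case
    proof
      fix G
      have "\<bar>qsum (tinj n G) (p # x) - qsum (thom n G) (p # x)\<bar>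
          \<le> \<bar>fst p * (tinj n G (snd p) - thom n G (snd p))\<bar> + \<bar>qsum (tinj n G) x - qsum (thom n G) x\<bar>"
        by (simp add: algebra_simps)
      also have "\<bar>fst p * (tinj n G (snd p) - thom n G (snd p))\<bar> \<le> \<bar>fst p\<bar> * \<eta>"
        unfolding abs_mult using elim by (intro mult_left_mono) (auto intro: less_imp_le)
      finally show "\<bar>qsum (tinj n G) (p # x) - qsum (thom n G) (p # x)\<bar> < \<delta>"
        using elim(1)[rule_format, of G] \<eta>(2) by linarith
    qed
  qed
qed simp

text \<open>The expansion of \<open>x\<close> in the idempotents with coefficients
  \<open>qsum (tinj n G) x\<close>, tested on an invariant parameter.\<close>

lemma qsum_eq_sum_tinj:
  assumes f: "iso_inv f" and x: "wf_qgraph x" and n: "\<And>p. p \<in> set x \<Longrightarrow> card (\<Union>(snd p)) \<le> n"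
  shows "qsum f x = (\<Sum>G\<in>Pow (all_pairs n). qsum (tinj n G) x * mobius (all_pairs n) f G)"
proof -
  have "qsum f x = qsum (\<lambda>F. \<Sum>G\<in>Pow (all_pairs n). mobius (all_pairs n) f G * tinj n G F) x"
    using iso_inv_eq_sum_tinj[OF f] x n
    by (intro qsum_cong) (simp add: wf_qgraph_def mult.commute[of "mobius _ _ _"])
  then show ?thesis by (simp add: qsum_sum qsum_scale mult.commute[of "qsum _ _"])
qed

text \<open>The idempotents add up to the unit, the empty graph: inversion at
  \<open>H = {}\<close>.\<close>

lemma sum_mobius: "(\<Sum>G\<in>Pow (all_pairs n). mobius (all_pairs n) f G) = f {}"
  using mobius_inversion[OF finite_all_pairs, of "{}" n f] by (simp add: atLeastAtMost_def Pow_def atMost_def)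

section \<open>Densities in graphons\<close>

abbreviation unit_measure :: "real measure" where
  "unit_measure \<equiv> restrict_space lborel {0..1}"

lemma prob_space_unit_measure: "prob_space unit_measure"
  by (rule prob_spaceI) (simp add: space_restrict_space emeasure_restrict_space)

lemma prob_space_PiM_unit_measure: "prob_space (PiM V (\<lambda>_. unit_measure))"
  by (intro prob_space_PiM prob_space_unit_measure)

text \<open>The integrand of \<open>tdens\<close>, separated so that it can be integrated over more
  coordinates than the nodes of \<open>E\<close>.\<close>

definition edge_prod :: "graph \<Rightarrow> (real \<Rightarrow> real \<Rightarrow> real) \<Rightarrow> (nat \<Rightarrow> real) \<Rightarrow> real" where
  "edge_prod E W x = (\<Prod>e\<in>E. W (x (Min e)) (x (Max e)))"

lemma tdens_eq: "tdens E W = (LINT x|PiM (\<Union>E) (\<lambda>_. unit_measure). edge_prod E W x)"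
  by (simp add: tdens_def edge_prod_def)

lemma edge_prod_bounds:
  assumes "graphon W" shows "0 \<le> edge_prod E W x" "edge_prod E W x \<le> 1"
  using assms unfolding edge_prod_def graphon_def by (auto intro!: prod_nonneg prod_le_1)

lemma Min_Max_edge:
  assumes "wf_graph E" "e \<in> E"
  shows "e = {Min e, Max e}" "Min e \<in> \<Union>E" "Max e \<in> \<Union>E"
proof -
  obtain a b where "e = {a, b}" using assms unfolding wf_graph_def by (meson card_2_iff)
  then show "e = {Min e, Max e}" "Min e \<in> \<Union>E" "Max e \<in> \<Union>E"
    using assms by (auto simp: min_def max_def)
qed

lemma edge_value_pair:
  assumes "graphon W"
  shows "W (x (Min {a, b})) (x (Max {a, b})) = W (x a) (x (b::nat))"
  using assms by (auto simp: graphon_def min_def max_def)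

lemma edge_prod_measurable:
  assumes W: "graphon W" and E: "wf_graph E" and V: "\<Union>E \<subseteq> V"
  shows "edge_prod E W \<in> borel_measurable (PiM V (\<lambda>_. unit_measure))"
proof -
  have id: "(\<lambda>t. t) \<in> borel_measurable unit_measure"
    by (rule measurable_restrict_space1) simp
  have comp: "(\<lambda>x. x v) \<in> borel_measurable (PiM V (\<lambda>_. unit_measure))" if "v \<in> V" for v
    using measurable_compose[OF measurable_component_singleton[OF that] id] by simp
  have W': "case_prod W \<in> borel_measurable (borel \<Otimes>\<^sub>M borel)"
    using W by (simp add: graphon_def borel_prod)
  have "(\<lambda>x. W (x (Min e)) (x (Max e))) \<in> borel_measurable (PiM V (\<lambda>_. unit_measure))" if "e \<in> E" for e
  proof -
    have "Min e \<in> V" "Max e \<in> V" using Min_Max_edge[OF E that] V by auto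
    then show ?thesis
      using measurable_compose[OF measurable_Pair[OF comp comp] W'] by simp
  qed
  then show ?thesis unfolding edge_prod_def[abs_def] by (intro borel_measurable_prod)
qed

lemma edge_prod_integrable:
  assumes W: "graphon W" and E: "wf_graph E" and V: "\<Union>E \<subseteq> V"
  shows "integrable (PiM V (\<lambda>_. unit_measure)) (edge_prod E W)"
proof -
  interpret prob_space "PiM V (\<lambda>_. unit_measure)" by (rule prob_space_PiM_unit_measure)
  show ?thesis
    by (rule integrable_const_bound[where B = 1])
       (use edge_prod_measurable[OF assms] edge_prod_bounds[OF W] in auto)
qed

text \<open>Selecting distinct coordinates pushes a product of probability measures forward to the
  product on those coordinates. A bijection \<open>f\<close> gives isomorphism invariance, the
  identity gives invariance under isolated nodes.\<close>

lemma tdens_reindex: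
  assumes W: "graphon W" and F: "wf_graph F" and f: "inj_on f (\<Union>F)" "f ` \<Union>F \<subseteq> V"
  shows "tdens F W = (LINT x|PiM V (\<lambda>_. unit_measure). edge_prod ((\<lambda>e. f ` e) ` F) W x)"
proof -
  let ?M = "\<lambda>V. PiM V (\<lambda>_::nat. unit_measure)"
  let ?t = "\<lambda>\<omega>::nat \<Rightarrow> real. \<lambda>n\<in>\<Union>F. \<omega> (f n)"
  have d: "distr (?M V) (?M (\<Union>F)) ?t = ?M (\<Union>F)"
    using f by (intro distr_PiM_reindex[of V "\<lambda>_. unit_measure" f "\<Union>F"] prob_space_unit_measure) auto
  have t: "?t \<in> measurable (?M V) (?M (\<Union>F))"
    using f by (intro measurable_restrict measurable_component_singleton) auto
  have "tdens F W = (LINT x|distr (?M V) (?M (\<Union>F)) ?t. edge_prod F W x)"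
    unfolding d tdens_eq ..
  also have "\<dots> = (LINT x|?M V. edge_prod F W (?t x))"
    by (rule integral_distr[OF t edge_prod_measurable[OF W F order_refl]])
  also have "\<dots> = (LINT x|?M V. edge_prod ((\<lambda>e. f ` e) ` F) W x)"
  proof (intro Bochner_Integration.integral_cong refl)
    fix x
    have "inj_on (\<lambda>e. f ` e) F"
      using inj_on_image[OF f(1)] .
    then have "edge_prod ((\<lambda>e. f ` e) ` F) W x = (\<Prod>e\<in>F. W (x (Min (f ` e))) (x (Max (f ` e))))"
      unfolding edge_prod_def by (simp add: prod.reindex)
    also have "\<dots> = edge_prod F W (?t x)"
      unfolding edge_prod_def
    proof (intro prod.cong refl)
      fix e assume e: "e \<in> F"
      note mm = Min_Max_edge[OF F e]
      \<comment> \<open>\<open>f\<close> may reverse the order of the two ends of an edge, which the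
        symmetry of \<open>W\<close> absorbs.\<close>
      have "f ` e = {f (Min e), f (Max e)}" using mm(1) by (metis image_insert image_empty)
      then show "W (x (Min (f ` e))) (x (Max (f ` e))) = W (?t x (Min e)) (?t x (Max e))"
        using mm edge_value_pair[OF W] by simp
    qed
    finally show "edge_prod F W (?t x) = edge_prod ((\<lambda>e. f ` e) ` F) W x" by simp
  qed
  finally show ?thesis .
qed

lemma tdens_superset:
  assumes "graphon W" "wf_graph F" "\<Union>F \<subseteq> V"
  shows "tdens F W = (LINT x|PiM V (\<lambda>_. unit_measure). edge_prod F W x)"
  using tdens_reindex[OF assms(1,2), of id V] assms(3) by simp

lemma iso_inv_tdens:
  assumes "graphon W" shows "iso_inv (\<lambda>F. tdens F W)"
  unfolding iso_inv_def
proof (intro allI impI)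
  fix E F assume E: "wf_graph E" and "giso E F"
  then obtain f where "inj_on f (\<Union>E)" "f ` \<Union>E = \<Union>F" "(\<lambda>e. f ` e) ` E = F"
    by (auto simp: giso_def bij_betw_def)
  then show "tdens E W = tdens F W"
    using tdens_reindex[OF assms E, of f "\<Union>F"] by (simp add: tdens_eq)
qed

lemma abs_tdens_le_1:
  assumes "graphon W" shows "\<bar>tdens E W\<bar> \<le> 1"
proof -
  interpret prob_space "PiM (\<Union>E) (\<lambda>_. unit_measure)" by (rule prob_space_PiM_unit_measure)
  show ?thesis
  \<comment> \<open>For an arbitrary \<open>E\<close> integrability may fail; the integral is then
    \<open>0\<close> by convention.\<close>
  proof (cases "integrable (PiM (\<Union>E) (\<lambda>_. unit_measure)) (edge_prod E W)")
    case True
    then have "tdens E W \<le> 1" unfolding tdens_eq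
      using edge_prod_bounds[OF assms] by (intro integral_le_const) auto
    moreover have "tdens E W \<ge> 0" unfolding tdens_eq
      using edge_prod_bounds[OF assms] by (intro integral_nonneg_AE) auto
    ultimately show ?thesis by simp
  qed (simp add: tdens_eq not_integrable_integral_eq)
qed

lemma tdens_empty: "tdens {} W = 1"
proof -
  interpret prob_space "PiM {} (\<lambda>_::nat. unit_measure)" by (rule prob_space_PiM_unit_measure)
  show ?thesis by (simp add: tdens_eq edge_prod_def prob_space)
qed

text \<open>Once all graphs of the interval are integrated over the same coordinates
  \<open>{..<n}\<close>, the alternating sum moves under the integral and becomes a product of
  factors \<open>W\<close> over \<open>G\<close> and \<open>1 - W\<close> over the other
  pairs.\<close>

lemma mobius_tdens_nonneg:
  assumes W: "graphon W" and G: "G \<subseteq> all_pairs n"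
  shows "mobius (all_pairs n) (\<lambda>F. tdens F W) G \<ge> 0"
proof -
  let ?M = "PiM {..<n} (\<lambda>_. unit_measure)" and ?P = "all_pairs n"
  have S: "wf_graph S" "\<Union>S \<subseteq> {..<n}" if "S \<in> {G..?P}" for S
    using that wf_graph_subset_all_pairs by (auto simp: all_pairs_def)
  have "mobius ?P (\<lambda>F. tdens F W) G
      = (\<Sum>S\<in>{G..?P}. LINT x|?M. (-1) ^ card (S - G) * edge_prod S W x)"
    unfolding mobius_def using S tdens_superset[OF W] by (intro sum.cong) simp_all
  also have "\<dots> = (LINT x|?M. (\<Sum>S\<in>{G..?P}. (-1) ^ card (S - G) * edge_prod S W x))"
    using S edge_prod_integrable[OF W]
    by (intro Bochner_Integration.integral_sum[symmetric] integrable_mult_right) auto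
  also have "\<dots> \<ge> 0"
  proof (intro Bochner_Integration.integral_nonneg)
    fix x
    have "0 \<le> (\<Prod>e\<in>G. W (x (Min e)) (x (Max e))) * (\<Prod>e\<in>?P - G. 1 - W (x (Min e)) (x (Max e)))"
      using W by (intro mult_nonneg_nonneg prod_nonneg) (auto simp: graphon_def)
    then show "0 \<le> (\<Sum>S\<in>{G..?P}. (-1) ^ card (S - G) * edge_prod S W x)"
      unfolding edge_prod_def using sum_prod_set_interval[OF finite_all_pairs G] by simp
  qed
  finally show ?thesis .
qed

text \<open>Ceilings (rather than floors) keep \<open>cell n 1 < n\<close>; truncated subtraction puts \<open>0\<close> into cell \<open>0\<close>.\<close>
definition cell :: "nat \<Rightarrow> real \<Rightarrow> nat" where
  "cell n t = nat \<lceil>real n * t\<rceil> - 1"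

text \<open>Two points in the same cell give a singleton, so for a graph \<open>G\<close> the
  diagonal blocks vanish.\<close>

definition step_graphon :: "nat \<Rightarrow> graph \<Rightarrow> real \<Rightarrow> real \<Rightarrow> real" where
  "step_graphon n G s t = of_bool ({cell n s, cell n t} \<in> G)"

lemma cell_measurable [measurable]: "cell n \<in> measurable borel (count_space UNIV)"
  unfolding cell_def by measurable

lemma graphon_step_graphon: "graphon (step_graphon n G)"
proof -
  have "case_prod (step_graphon n G)
      = (\<lambda>p. (\<lambda>(i, j). of_bool ({i, j} \<in> G)) (cell n (fst p), cell n (snd p)))"
    by (auto simp: step_graphon_def)
  also have "\<dots> \<in> borel_measurable (borel \<Otimes>\<^sub>M borel)"
    by (rule measurable_compose[of _ _ "count_space UNIV \<Otimes>\<^sub>M count_space UNIV"])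
       (simp_all add: pair_measure_countable)
  finally show ?thesis
    unfolding graphon_def by (auto simp: step_graphon_def borel_prod insert_commute)
qed

lemma cell_less: "n \<ge> 1 \<Longrightarrow> t \<le> 1 \<Longrightarrow> cell n t < n"
proof -
  assume "n \<ge> 1" "t \<le> 1"
  then have "\<lceil>real n * t\<rceil> \<le> int n" by (simp add: ceiling_le_iff mult_left_le)
  then show ?thesis using \<open>n \<ge> 1\<close> unfolding cell_def by linarith
qed

lemma integral_cell:
  assumes "j < n"
  shows "(LINT t|unit_measure. of_bool (cell n t = j)) = 1 / real n"
proof -
  define A where "A = (if j = 0 then {0..1 / real n} else {real j / n<..(real j + 1) / n})"
  have n: "real n > 0" "real j + 1 \<le> real n" using assms by auto
  have "cell n t = j \<longleftrightarrow> t \<in> A" if "t \<in> {0..1}" for t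
  proof (cases "j = 0")
    case True
    have "cell n t = 0 \<longleftrightarrow> \<lceil>real n * t\<rceil> \<le> 1" unfolding cell_def by linarith
    also have "\<dots> \<longleftrightarrow> t \<le> 1 / real n" using n by (simp add: ceiling_le_iff field_simps)
    finally show ?thesis using True that by (simp add: A_def)
  next
    case False
    have "cell n t = j \<longleftrightarrow> \<lceil>real n * t\<rceil> = int j + 1" unfolding cell_def using False by linarith
    also have "\<dots> \<longleftrightarrow> real j < real n * t \<and> real n * t \<le> real j + 1"
      by (simp add: ceiling_eq_iff)
    also have "\<dots> \<longleftrightarrow> t \<in> A" using n False by (simp add: A_def field_simps)
    finally show ?thesis .
  qed
  moreover have "A \<subseteq> {0..1}"
  proof -
    have "{a<..b} \<subseteq> {0..1} \<and> {0..b} \<subseteq> {0..1}" if "0 \<le> a" "b \<le> 1" for a b :: real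
      using that by auto
    from this[of "real j / n" "(real j + 1) / n"] show ?thesis
      using n unfolding A_def by (auto split: if_splits)
  qed
  ultimately have eq: "indicator {0..1} t *\<^sub>R of_bool (cell n t = j) = (indicator A t :: real)" for t
    by (auto simp: indicator_def)
  have "(LINT t|unit_measure. of_bool (cell n t = j) :: real) = (LINT t|lborel. indicator A t)"
    by (subst integral_restrict_space) (simp_all only: eq, simp_all)
  also have "\<dots> = 1 / real n" using n by (auto simp: A_def field_simps)
  finally show ?thesis .
qed

text \<open>The cube splits into \<open>n ^ card V\<close> boxes of equal volume, one for each map
  from \<open>V\<close> to cells. The integrand is the indicator of the boxes belonging to
  homomorphisms.\<close>

lemma integral_step_graphon:
  assumes n: "n \<ge> 1" and V: "finite V" "\<Union>F \<subseteq> V" and F: "wf_graph F"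
  shows "(LINT x|PiM V (\<lambda>_. unit_measure). edge_prod F (step_graphon n G) x)
    = card (hom_maps V F n G) / n ^ card V"
proof -
  let ?M = "PiM V (\<lambda>_. unit_measure)"
  interpret product_sigma_finite "\<lambda>_::nat. unit_measure"
    using prob_space_unit_measure
    by (simp add: product_sigma_finite_def prob_space_imp_sigma_finite)
  have fA: "finite (V \<rightarrow>\<^sub>E {..<n})" using V by (simp add: finite_PiE)
  have int1: "integrable unit_measure (\<lambda>t. of_bool (cell n t = j) :: real)" for j
  proof -
    interpret U: prob_space unit_measure by (rule prob_space_unit_measure)
    have "(\<lambda>t. of_bool (cell n t = j) :: real) \<in> borel_measurable unit_measure"
      by (rule measurable_restrict_space1) simp
    then show ?thesis by (intro U.integrable_const_bound[where B = 1]) auto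
  qed
  have "(LINT x|?M. edge_prod F (step_graphon n G) x)
      = (LINT x|?M. (\<Sum>\<phi>\<in>hom_maps V F n G. \<Prod>v\<in>V. of_bool (cell n (x v) = \<phi> v)))"
  proof (intro Bochner_Integration.integral_cong refl)
    fix x assume x: "x \<in> space ?M"
    define \<psi> where "\<psi> = (\<lambda>v\<in>V. cell n (x v))"
    have xv: "x v \<in> {0..1}" if "v \<in> V" for v
      using x that by (auto simp: space_PiM space_restrict_space PiE_iff)
    have \<psi>: "\<psi> \<in> V \<rightarrow>\<^sub>E {..<n}" using xv n by (auto simp: \<psi>_def intro!: cell_less)
    have "edge_prod F (step_graphon n G) x = (\<Prod>e\<in>F. of_bool (\<psi> ` e \<in> G))"
      unfolding edge_prod_def
    proof (intro prod.cong refl)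
      fix e assume "e \<in> F"
      note mm = Min_Max_edge[OF F this]
      have "\<psi> ` e = {\<psi> (Min e), \<psi> (Max e)}" using mm(1) by (metis image_insert image_empty)
      also have "\<dots> = {cell n (x (Min e)), cell n (x (Max e))}"
        using mm V by (auto simp: \<psi>_def)
      finally show "step_graphon n G (x (Min e)) (x (Max e)) = of_bool (\<psi> ` e \<in> G)"
        by (simp add: step_graphon_def)
    qed
    also have "\<dots> = of_bool (\<forall>e\<in>F. \<psi> ` e \<in> G)"
      using F by (auto simp: wf_graph_def)
    \<comment> \<open>The point \<open>x\<close> lies in exactly one box, that of
      \<open>\<psi>\<close>.\<close>
    also have "\<dots> = (\<Sum>\<phi>\<in>hom_maps V F n G. if \<phi> = \<psi> then 1 else 0)"
      using \<psi> finite_hom_maps[OF V(1)] by (simp add: hom_maps_def)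
    also have "\<dots> = (\<Sum>\<phi>\<in>hom_maps V F n G. \<Prod>v\<in>V. of_bool (cell n (x v) = \<phi> v))"
    proof (intro sum.cong refl)
      fix \<phi> assume "\<phi> \<in> hom_maps V F n G"
      then have "\<phi> = \<psi> \<longleftrightarrow> (\<forall>v\<in>V. cell n (x v) = \<phi> v)"
        by (auto simp: hom_maps_def \<psi>_def PiE_iff extensional_def fun_eq_iff)
      then show "(if \<phi> = \<psi> then 1 else 0) = (\<Prod>v\<in>V. of_bool (cell n (x v) = \<phi> v) :: real)"
        using V by auto
    qed
    finally show "edge_prod F (step_graphon n G) x
       = (\<Sum>\<phi>\<in>hom_maps V F n G. \<Prod>v\<in>V. of_bool (cell n (x v) = \<phi> v))" .
  qed
  also have "\<dots> = (\<Sum>\<phi>\<in>hom_maps V F n G. LINT x|?M. (\<Prod>v\<in>V. of_bool (cell n (x v) = \<phi> v)))"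
    using V int1 by (intro Bochner_Integration.integral_sum product_integrable_prod)
  also have "\<dots> = (\<Sum>\<phi>\<in>hom_maps V F n G. (1 / real n) ^ card V)"
  proof (intro sum.cong refl)
    fix \<phi> assume \<phi>: "\<phi> \<in> hom_maps V F n G"
    have "(LINT x|?M. (\<Prod>v\<in>V. of_bool (cell n (x v) = \<phi> v)))
        = (\<Prod>v\<in>V. LINT t|unit_measure. of_bool (cell n t = \<phi> v) :: real)"
      using V int1 by (intro product_integral_prod)
    also have "\<dots> = (\<Prod>v\<in>V. 1 / real n)"
      using \<phi> by (intro prod.cong refl integral_cell) (auto simp: hom_maps_def)
    finally show "(LINT x|?M. (\<Prod>v\<in>V. of_bool (cell n (x v) = \<phi> v))) = (1 / real n) ^ card V"
      by simp
  qed
  finally show ?thesis by (simp add: power_divide)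
qed

lemma thom_eq_tdens: "n \<ge> 1 \<Longrightarrow> wf_graph F \<Longrightarrow> thom n G F = tdens F (step_graphon n G)"
  unfolding tdens_eq thom_def by (simp add: integral_step_graphon finite_Union_wf_graph)

text \<open>Isolated nodes leave the density unchanged because both sides are integrals of the same
  step graphon.\<close>

lemma thom_superset:
  assumes "n \<ge> 1" "finite V" "\<Union>F \<subseteq> V" "wf_graph F"
  shows "thom n G F = card (hom_maps V F n G) / n ^ card V"
  using assms integral_step_graphon thom_eq_tdens tdens_superset[OF graphon_step_graphon]
  by metis

section \<open>Squares of labeled quantum graphs\<close>

lemma inj_lab_shift: "b \<le> 1 \<Longrightarrow> inj (lab_shift k b)"
  unfolding lab_shift_def inj_def by auto

lemma wf_graph_lprod:
  assumes "wf_graph F" "wf_graph H" shows "wf_graph (lprod k F H)"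
  using wf_graph_image[OF assms(1) inj_on_subset[OF inj_lab_shift[of 0 k]]]
    wf_graph_image[OF assms(2) inj_on_subset[OF inj_lab_shift[of 1 k]]]
  unfolding lprod_def wf_graph_def by auto

lemma wf_qgraph_lsq: "wf_qgraph y \<Longrightarrow> wf_qgraph (lsq k y)"
  unfolding wf_qgraph_def lsq_def by (auto intro!: wf_graph_lprod)

text \<open>With all \<open>n\<close> nodes labeled nothing is renamed, so the product is the union
  to which \<open>mobius_idempotent\<close> applies.\<close>

lemma lprod_all_pairs:
  assumes "S \<subseteq> all_pairs n" "T \<subseteq> all_pairs n"
  shows "lprod n S T = S \<union> T"
proof -
  have "lab_shift n b ` e = e" if "e \<in> all_pairs n" for b e
    using that by (force simp: all_pairs_def lab_shift_def)
  then have "(\<lambda>e. lab_shift n b ` e) ` S = S" if "S \<subseteq> all_pairs n" for b S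
    using that by (metis (no_types, lifting) image_cong image_ident subset_iff)
  then show ?thesis using assms by (simp add: lprod_def)
qed

text \<open>\<open>lab_shift\<close> sends the unlabeled nodes of the two factors to even and odd
  offsets above \<open>k\<close>. A map on all nodes is thus a triple: \<open>\<psi>\<close> on the
  labels, \<open>\<alpha>\<close> and \<open>\<beta>\<close> on the unlabeled parts.\<close>

lemma sum_labeled_maps:
  fixes k M n :: nat and g :: "(nat \<Rightarrow> nat) \<Rightarrow> (nat \<Rightarrow> nat) \<Rightarrow> (nat \<Rightarrow> nat) \<Rightarrow> real"
  defines "U \<equiv> {k..<k + M}"
  shows "(\<Sum>\<phi>\<in>{..<k + 2 * M} \<rightarrow>\<^sub>E {..<n}. g (restrict \<phi> {..<k})
            (\<lambda>v\<in>U. \<phi> (lab_shift k 0 v)) (\<lambda>v\<in>U. \<phi> (lab_shift k 1 v)))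
    = (\<Sum>\<psi>\<in>{..<k} \<rightarrow>\<^sub>E {..<n}. \<Sum>\<alpha>\<in>U \<rightarrow>\<^sub>E {..<n}. \<Sum>\<beta>\<in>U \<rightarrow>\<^sub>E {..<n}. g \<psi> \<alpha> \<beta>)"
proof -
  define i :: "(nat \<Rightarrow> nat) \<times> (nat \<Rightarrow> nat) \<times> (nat \<Rightarrow> nat) \<Rightarrow> nat \<Rightarrow> nat" where
    "i = (\<lambda>(\<psi>, \<alpha>, \<beta>) v. if v < k then \<psi> v else if v < k + 2 * M then
        (if even (v - k) then \<alpha> (k + (v - k) div 2) else \<beta> (k + (v - k) div 2)) else undefined)"
  define j :: "(nat \<Rightarrow> nat) \<Rightarrow> (nat \<Rightarrow> nat) \<times> (nat \<Rightarrow> nat) \<times> (nat \<Rightarrow> nat)" where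
    "j = (\<lambda>\<phi>. (restrict \<phi> {..<k}, \<lambda>v\<in>U. \<phi> (lab_shift k 0 v), \<lambda>v\<in>U. \<phi> (lab_shift k 1 v)))"
  have "(\<Sum>\<phi>\<in>{..<k + 2 * M} \<rightarrow>\<^sub>E {..<n}. g (restrict \<phi> {..<k})
            (\<lambda>v\<in>U. \<phi> (lab_shift k 0 v)) (\<lambda>v\<in>U. \<phi> (lab_shift k 1 v)))
    = (\<Sum>(\<psi>, \<alpha>, \<beta>)\<in>({..<k} \<rightarrow>\<^sub>E {..<n}) \<times> (U \<rightarrow>\<^sub>E {..<n}) \<times> (U \<rightarrow>\<^sub>E {..<n}). g \<psi> \<alpha> \<beta>)"
  proof (rule sum.reindex_bij_witness[of _ i j])
    fix \<phi> assume \<phi>: "\<phi> \<in> {..<k + 2 * M} \<rightarrow>\<^sub>E {..<n}"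
    show "i (j \<phi>) = \<phi>"
    proof
      fix v
      consider "v < k" | "k \<le> v" "v < k + 2 * M" | "v \<ge> k + 2 * M" by linarith
      then show "i (j \<phi>) v = \<phi> v"
      proof cases
        case 2
        \<comment> \<open>Halving the offset recovers the original node, and its parity tells the
          factor.\<close>
        define w where "w = k + (v - k) div 2"
        have w: "w \<in> U" "\<not> w < k" using 2 by (auto simp: w_def U_def)
        have "lab_shift k ((v - k) mod 2) w = v"
          using 2 by (simp add: lab_shift_def w_def)
        then show ?thesis using 2 w
          by (auto simp: i_def j_def w_def[symmetric] even_iff_mod_2_eq_zero odd_iff_mod_2_eq_one)
      next
        case 3
        then show ?thesis using PiE_arb[OF \<phi>, of v] by (simp add: i_def j_def)
      qed (auto simp: i_def j_def)
    qed
    show "j \<phi> \<in> ({..<k} \<rightarrow>\<^sub>E {..<n}) \<times> (U \<rightarrow>\<^sub>E {..<n}) \<times> (U \<rightarrow>\<^sub>E {..<n})"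
    proof -
      have "\<phi> v < n" if "v < k + 2 * M" for v using \<phi> that by auto
      then show ?thesis by (auto simp: j_def U_def lab_shift_def)
    qed
    show "(case j \<phi> of (\<psi>, \<alpha>, \<beta>) \<Rightarrow> g \<psi> \<alpha> \<beta>) = g (restrict \<phi> {..<k})
            (\<lambda>v\<in>U. \<phi> (lab_shift k 0 v)) (\<lambda>v\<in>U. \<phi> (lab_shift k 1 v))"
      by (simp add: j_def)
  next
    fix t assume "t \<in> ({..<k} \<rightarrow>\<^sub>E {..<n}) \<times> (U \<rightarrow>\<^sub>E {..<n}) \<times> (U \<rightarrow>\<^sub>E {..<n})"
    then obtain \<psi> \<alpha> \<beta> where t: "t = (\<psi>, \<alpha>, \<beta>)" "\<psi> \<in> {..<k} \<rightarrow>\<^sub>E {..<n}"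
        "\<alpha> \<in> U \<rightarrow>\<^sub>E {..<n}" "\<beta> \<in> U \<rightarrow>\<^sub>E {..<n}" by auto
    have U: "k + (v - k) div 2 \<in> U" if "k \<le> v" "v < k + 2 * M" for v
      using that by (auto simp: U_def)
    show "i t \<in> {..<k + 2 * M} \<rightarrow>\<^sub>E {..<n}"
    proof (rule PiE_I)
      fix v assume "v \<in> {..<k + 2 * M}"
      then show "i t v \<in> {..<n}"
        using PiE_mem[OF t(2), of v] PiE_mem[OF t(3) U, of v] PiE_mem[OF t(4) U, of v]
        by (auto simp: i_def t(1))
    qed (auto simp: i_def t(1))
    have "restrict (i t) {..<k} = \<psi>"
      by (rule ext) (use PiE_arb[OF t(2)] in \<open>simp add: i_def t(1) restrict_def\<close>)
    moreover have "(\<lambda>v\<in>U. i t (lab_shift k 0 v)) = \<alpha>"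
      by (rule ext) (use PiE_arb[OF t(3)] in \<open>auto simp: i_def t(1) restrict_def lab_shift_def U_def\<close>)
    moreover have "(\<lambda>v\<in>U. i t (lab_shift k 1 v)) = \<beta>"
      by (rule ext) (use PiE_arb[OF t(4)] in \<open>auto simp: i_def t(1) restrict_def lab_shift_def U_def\<close>)
    ultimately show "j (i t) = t" by (simp add: j_def t(1))
  qed
  then show ?thesis by (simp add: sum.cartesian_product)
qed

text \<open>Once the images \<open>\<psi>\<close> of the labels are fixed, the two factors are
  mapped independently, so each \<open>\<psi>\<close> contributes a square.\<close>

lemma qsum_thom_lsq_nonneg:
  assumes n: "n \<ge> 1" and y: "wf_qgraph y"
  shows "qsum (thom n G) (lsq k y) \<ge> 0"
proof -
  have "finite (\<Union>p\<in>set y. \<Union>(snd p))"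
    using y by (auto simp: wf_qgraph_def intro: finite_Union_wf_graph)
  \<comment> \<open>\<open>M\<close> bounds all node names in \<open>y\<close>, so all products fit
    into \<open>k + 2 * M\<close> nodes.\<close>
  then obtain M where M: "(\<Union>p\<in>set y. \<Union>(snd p)) \<subseteq> {..<M}"
    using finite_nat_bounded by blast
  define U where "U = {k..<k + M}"
  let ?V = "{..<k + 2 * M}"
  define h :: "(nat \<Rightarrow> nat) \<Rightarrow> (nat \<Rightarrow> nat) \<Rightarrow> graph \<Rightarrow> real" where
    "h = (\<lambda>\<psi> \<alpha> F. of_bool (\<forall>e\<in>F. (\<lambda>v. if v < k then \<psi> v else \<alpha> v) ` e \<in> G))"
  have *: "thom n G (lprod k F H) = (\<Sum>\<psi>\<in>{..<k} \<rightarrow>\<^sub>E {..<n}. \<Sum>\<alpha>\<in>U \<rightarrow>\<^sub>E {..<n}. \<Sum>\<beta>\<in>U \<rightarrow>\<^sub>E {..<n}.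
      h \<psi> \<alpha> F * h \<psi> \<beta> H) / n ^ (k + 2 * M)"
    if FH: "wf_graph F" "wf_graph H" "\<Union>F \<subseteq> {..<M}" "\<Union>H \<subseteq> {..<M}" for F H
  proof -
    have fin: "finite (?V \<rightarrow>\<^sub>E {..<n})" by (intro finite_PiE) simp_all
    have lt: "v < M" if "e \<in> F \<or> e \<in> H" "v \<in> e" for e v using that FH by auto
    have lt': "v < k + M" if "e \<in> F \<or> e \<in> H" "v \<in> e" for e v
      using lt[OF that] by simp
    have im: "(\<lambda>v. if v < k then restrict \<phi> {..<k} v else (\<lambda>v\<in>U. \<phi> (lab_shift k b v)) v) ` e
        = \<phi> ` (lab_shift k b ` e)" if "e \<in> F \<or> e \<in> H" for \<phi> :: "nat \<Rightarrow> nat" and b e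
      unfolding image_image using that
      by (intro image_cong refl) (auto simp: U_def lab_shift_def lt')
    have h: "h (restrict \<phi> {..<k}) (\<lambda>v\<in>U. \<phi> (lab_shift k b v)) X = of_bool (\<forall>e\<in>X. \<phi> ` (lab_shift k b ` e) \<in> G)"
      if "X = F \<or> X = H" for X b and \<phi> :: "nat \<Rightarrow> nat"
      unfolding h_def using that
      by (intro arg_cong[where f = of_bool] ball_cong refl) (subst im; auto)
    have ls: "lab_shift k b v < k + 2 * M" if "b \<le> 1" "v < M" for b v
      using that by (auto simp: lab_shift_def)
    have "\<Union>(lprod k F H) \<subseteq> ?V" unfolding lprod_def by (auto intro!: ls intro: lt)
    then have "thom n G (lprod k F H) = card (hom_maps ?V (lprod k F H) n G) / n ^ (k + 2 * M)"
      using thom_superset[OF n finite_lessThan _ wf_graph_lprod[OF FH(1,2)]] by simp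
    also have "hom_maps ?V (lprod k F H) n G = (?V \<rightarrow>\<^sub>E {..<n}) \<inter> {\<phi>. \<forall>e\<in>lprod k F H. \<phi> ` e \<in> G}"
      by (simp only: hom_maps_def Int_def mem_Collect_eq)
    also have "real (card \<dots>) = (\<Sum>\<phi>\<in>?V \<rightarrow>\<^sub>E {..<n}. of_bool (\<forall>e\<in>lprod k F H. \<phi> ` e \<in> G))"
      by (rule sum_of_bool_eq[OF fin fin, symmetric])
    \<comment> \<open>A condition on a union of edge sets is a conjunction, so an edge in both
      factors is harmless.\<close>
    also have "\<dots> = (\<Sum>\<phi>\<in>?V \<rightarrow>\<^sub>E {..<n}.
        h (restrict \<phi> {..<k}) (\<lambda>v\<in>U. \<phi> (lab_shift k 0 v)) F * h (restrict \<phi> {..<k}) (\<lambda>v\<in>U. \<phi> (lab_shift k 1 v)) H)"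
      by (simp add: h lprod_def ball_Un flip: of_bool_conj)
    also have "\<dots> = (\<Sum>\<psi>\<in>{..<k} \<rightarrow>\<^sub>E {..<n}. \<Sum>\<alpha>\<in>U \<rightarrow>\<^sub>E {..<n}. \<Sum>\<beta>\<in>U \<rightarrow>\<^sub>E {..<n}. h \<psi> \<alpha> F * h \<psi> \<beta> H)"
      unfolding U_def by (rule sum_labeled_maps)
    finally show ?thesis .
  qed
  let ?c = "1 / real n ^ (k + 2 * M)"
  have "qsum (thom n G) (lsq k y) = qsum (\<lambda>F. qsum (\<lambda>H. ?c * (\<Sum>\<psi>\<in>{..<k} \<rightarrow>\<^sub>E {..<n}. \<Sum>\<alpha>\<in>U \<rightarrow>\<^sub>E {..<n}. \<Sum>\<beta>\<in>U \<rightarrow>\<^sub>E {..<n}.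
      h \<psi> \<alpha> F * h \<psi> \<beta> H)) y) y"
    unfolding qsum_lsq using y M by (intro qsum_cong) (auto simp: * wf_qgraph_def SUP_le_iff)
  also have "\<dots> = ?c * (\<Sum>\<psi>\<in>{..<k} \<rightarrow>\<^sub>E {..<n}. \<Sum>\<alpha>\<in>U \<rightarrow>\<^sub>E {..<n}. \<Sum>\<beta>\<in>U \<rightarrow>\<^sub>E {..<n}.
      qsum (\<lambda>F. qsum (h \<psi> \<beta>) y * h \<psi> \<alpha> F) y)"
    by (simp only: qsum_scale qsum_sum mult.commute[of "h _ _ _" "qsum _ _"])
  also have "\<dots> = ?c * (\<Sum>\<psi>\<in>{..<k} \<rightarrow>\<^sub>E {..<n}. (\<Sum>\<alpha>\<in>U \<rightarrow>\<^sub>E {..<n}. qsum (h \<psi> \<alpha>) y)\<^sup>2)"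
    unfolding qsum_scale power2_eq_square sum_product by (simp only: mult.commute)
  also have "\<dots> \<ge> 0" by (intro mult_nonneg_nonneg sum_nonneg) auto
  finally show ?thesis .
qed

lemma qeval_lsq_nonneg:
  assumes W: "graphon W" and y: "wf_qgraph y"
  shows "qeval (lsq k y) W \<ge> 0"
proof (rule field_le_epsilon)
  fix \<delta> :: real assume "\<delta> > 0"
  let ?w = "lsq k y" and ?f = "\<lambda>F. tdens F W"
  note w = wf_qgraph_lsq[OF y, of k]
  \<comment> \<open>From \<open>m\<close> on, every graph of the list embeds injectively; the
    inserted \<open>1\<close> covers the empty list and keeps \<open>n\<close> positive.\<close>
  define m where "m = Max (insert 1 ((\<lambda>p. card (\<Union>(snd p))) ` set ?w))"
  have m: "1 \<le> m" "\<And>p. p \<in> set ?w \<Longrightarrow> card (\<Union>(snd p)) \<le> m"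
    unfolding m_def by (auto intro!: Max_ge)
  from eventually_qsum_tinj_thom_close[OF w \<open>\<delta> > 0\<close>] eventually_ge_at_top[of m]
  have "\<forall>\<^sub>F n in sequentially. m \<le> n \<and> (\<forall>G. \<bar>qsum (tinj n G) ?w - qsum (thom n G) ?w\<bar> < \<delta>)"
    by eventually_elim auto
  then obtain n where n: "m \<le> n" "\<And>G. \<bar>qsum (tinj n G) ?w - qsum (thom n G) ?w\<bar> < \<delta>"
    by (auto simp: eventually_sequentially)
  have ge: "qsum (tinj n G) ?w \<ge> -\<delta>" for G
    using n(2)[of G] qsum_thom_lsq_nonneg[of n y G k] n(1) m(1) y by linarith
  have "-\<delta> = (\<Sum>G\<in>Pow (all_pairs n). -\<delta> * mobius (all_pairs n) ?f G)"
    by (simp only: sum_distrib_left[symmetric] sum_mobius tdens_empty mult_1_right)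
  also have "\<dots> \<le> (\<Sum>G\<in>Pow (all_pairs n). qsum (tinj n G) ?w * mobius (all_pairs n) ?f G)"
    using ge mobius_tdens_nonneg[OF W] by (intro sum_mono mult_right_mono) auto
  also have "\<dots> = qeval ?w W"
    unfolding qeval_eq_qsum using m(2) n(1)
    by (intro qsum_eq_sum_tinj[symmetric] iso_inv_tdens[OF W] w) (auto intro: order_trans)
  finally show "0 \<le> qeval ?w W + \<delta>" by simp
qed

section \<open>The two directions of the equivalence\<close>

lemma wf_qgraph_qminus: "wf_qgraph x \<Longrightarrow> wf_qgraph y \<Longrightarrow> wf_qgraph (qminus x y)"
  by (auto simp: wf_qgraph_def qminus_def)

lemma wf_qgraph_concat_lsq: "(\<And>y. y \<in> set ys \<Longrightarrow> wf_qgraph y) \<Longrightarrow> wf_qgraph (concat (map (lsq k) ys))"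
  unfolding wf_qgraph_def[of "concat _"]
proof
  fix p assume ys: "\<And>y. y \<in> set ys \<Longrightarrow> wf_qgraph y" and "p \<in> set (concat (map (lsq k) ys))"
  then obtain y where "y \<in> set ys" "p \<in> set (lsq k y)" by auto
  then show "wf_graph (snd p)" using wf_qgraph_lsq[OF ys] unfolding wf_qgraph_def by blast
qed

text \<open>Evaluation at \<open>W\<close> is linear and bounded by \<open>qnorm1\<close>, so
  \<open>qeval x W\<close> is within \<open>\<epsilon>\<close> of the nonnegative value of a sum of
  squares.\<close>

lemma qnonneg_of_approx:
  assumes x: "wf_qgraph x"
    and approx: "\<And>\<epsilon>. \<epsilon> > 0 \<Longrightarrow> \<exists>k ys. (\<forall>y\<in>set ys. wf_qgraph y) \<and>
        qnorm1 (qminus x (concat (map (lsq k) ys))) < \<epsilon>"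
  shows "qnonneg x"
  unfolding qnonneg_def
proof (intro allI impI)
  fix W assume W: "graphon W"
  show "0 \<le> qeval x W"
  proof (rule field_le_epsilon)
    fix \<epsilon> :: real assume "\<epsilon> > 0"
    then obtain k ys where ys: "\<And>y. y \<in> set ys \<Longrightarrow> wf_qgraph y"
      and lt: "qnorm1 (qminus x (concat (map (lsq k) ys))) < \<epsilon>"
      using approx by blast
    let ?s = "concat (map (lsq k) ys)"
    have "\<bar>qeval x W - qeval ?s W\<bar> \<le> qnorm1 (qminus x ?s)"
      using abs_qsum_le_qnorm1[OF wf_qgraph_qminus[OF x wf_qgraph_concat_lsq[OF ys]] iso_inv_tdens[OF W] abs_tdens_le_1[OF W]]
      by (simp add: qeval_eq_qsum qsum_qminus)
    moreover have "qeval ?s W = (\<Sum>y\<leftarrow>ys. qeval (lsq k y) W)"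
      by (simp add: qeval_eq_qsum qsum_concat o_def)
    then have "qeval ?s W \<ge> 0"
      using qeval_lsq_nonneg[OF W ys] by (auto intro!: sum_list_nonneg)
    ultimately show "0 \<le> qeval x W + \<epsilon>" using lt by linarith
  qed
qed

text \<open>The class of the empty graph is \<open>{{}}\<close>, so at most one class
  contributes.\<close>

lemma qnorm1_le_of_empty_graph_only:
  assumes "\<And>C. C \<in> qclasses z \<Longrightarrow> \<bar>qcoef z C\<bar> = \<delta> * of_bool ({} \<in> C)" "\<delta> \<ge> 0"
  shows "qnorm1 z \<le> \<delta>"
proof -
  have eq: "C = {{}}" if "C \<in> qclasses z" "{} \<in> C" for C
  proof -
    obtain F where C: "C = {E. giso E F}" using \<open>C \<in> qclasses z\<close> by (auto simp: qclasses_def)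
    with \<open>{} \<in> C\<close> have "F = {}" by (auto simp: giso_def)
    then show "C = {{}}" using C by (auto simp: giso_def bij_betw_def)
  qed
  have "qnorm1 z \<le> (\<Sum>C\<in>qclasses z. if C = {{}} then \<delta> else 0)"
    unfolding qnorm1_def
  proof (intro sum_mono)
    fix C assume "C \<in> qclasses z"
    then show "\<bar>qcoef z C\<bar> \<le> (if C = {{}} then \<delta> else 0)"
      using assms(1)[of C] eq[of C] assms(2) by (cases "{} \<in> C") simp_all
  qed
  also have "\<dots> \<le> \<delta>" using assms(2) by (simp add: qclasses_def)
  finally show ?thesis .
qed

lemma approx_of_qnonneg:
  assumes x: "wf_qgraph x" and nn: "qnonneg x" and "\<delta> > 0"
  shows "\<exists>k\<ge>1. \<exists>ys. (\<forall>y\<in>set ys. wf_qgraph y) \<and>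
        qnorm1 (qminus x (concat (map (lsq k) ys))) \<le> \<delta>"
proof -
  define m where "m = Max (insert 1 ((\<lambda>p. card (\<Union>(snd p))) ` set x))"
  have m: "1 \<le> m" "\<And>p. p \<in> set x \<Longrightarrow> card (\<Union>(snd p)) \<le> m"
    unfolding m_def by (auto intro!: Max_ge)
  from eventually_qsum_tinj_thom_close[OF x \<open>\<delta> > 0\<close>] eventually_ge_at_top[of m]
  have "\<forall>\<^sub>F n in sequentially. m \<le> n \<and> (\<forall>G. \<bar>qsum (tinj n G) x - qsum (thom n G) x\<bar> < \<delta>)"
    by eventually_elim auto
  then obtain n where n: "m \<le> n" "\<And>G. \<bar>qsum (tinj n G) x - qsum (thom n G) x\<bar> < \<delta>"
    by (auto simp: eventually_sequentially)
  have n1: "n \<ge> 1" using n m by simp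
  let ?P = "all_pairs n"
  \<comment> \<open>The coefficient of \<open>e\<^sub>G\<close> in \<open>x + \<delta>\<close>; it
    is nonnegative because \<open>thom\<close> is evaluation at a step graphon.\<close>
  define c where "c = (\<lambda>G. qsum (tinj n G) x + \<delta>)"
  have c: "c G \<ge> 0" for G
  proof -
    have "qsum (thom n G) x = qeval x (step_graphon n G)"
      unfolding qeval_eq_qsum using x n1
      by (intro qsum_cong thom_eq_tdens) (auto simp: wf_qgraph_def)
    then have "qsum (thom n G) x \<ge> 0" using nn graphon_step_graphon by (simp add: qnonneg_def)
    then show ?thesis using n(2)[of G] by (simp add: c_def)
  qed
  obtain LG where LG: "distinct LG" "set LG = Pow ?P"
    using finite_distinct_list[of "Pow ?P"] finite_all_pairs by auto
  obtain L where L: "\<And>G. distinct (L G)" "\<And>G. set (L G) = {G..?P}"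
  proof -
    have "\<forall>G. \<exists>L. distinct L \<and> set L = {G..?P}"
      using finite_distinct_list[OF finite_set_interval[OF finite_all_pairs[of n]]] by blast
    then show ?thesis using that by metis
  qed
  \<comment> \<open>The element \<open>sqrt (c G)\<close> times \<open>e\<^sub>G\<close>, with all
    \<open>n\<close> nodes labeled.\<close>
  define y where "y = (\<lambda>G. map (\<lambda>S. (sqrt (c G) * (-1) ^ card (S - G), S)) (L G))"
  define ys where "ys = map y LG"
  have wf: "wf_qgraph v" if "v \<in> set ys" for v
    using that wf_graph_subset_all_pairs by (auto simp: ys_def y_def wf_qgraph_def L)
  let ?s = "concat (map (lsq n) ys)"
  have sq: "qsum f (lsq n (y G)) = c G * mobius ?P f G" if "G \<subseteq> ?P" for f G
  proof -
    have "qsum f (lsq n (y G)) = (\<Sum>S\<in>{G..?P}. sqrt (c G) * (-1) ^ card (S - G) *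
        (\<Sum>T\<in>{G..?P}. sqrt (c G) * (-1) ^ card (T - G) * f (lprod n S T)))"
      unfolding qsum_lsq by (simp add: y_def qsum_map_signed_set L)
    also have "\<dots> = (\<Sum>S\<in>{G..?P}. \<Sum>T\<in>{G..?P}. (sqrt (c G) * sqrt (c G)) *
        ((-1) ^ card (S - G) * (-1) ^ card (T - G) * f (S \<union> T)))"
      unfolding sum_distrib_left
      by (intro sum.cong refl) (simp add: lprod_all_pairs mult_ac)
    also have "\<dots> = c G * mobius ?P f G"
      unfolding sum_distrib_left[symmetric] mobius_idempotent[OF finite_all_pairs that]
      using c by simp
    finally show ?thesis .
  qed
  \<comment> \<open>The sum of the squares is \<open>x\<close> plus \<open>\<delta>\<close> times
    the empty graph, as seen by every invariant parameter.\<close>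
  have s: "qsum f ?s = qsum f x + \<delta> * f {}" if "iso_inv f" for f
  proof -
    have "qsum f ?s = (\<Sum>G\<leftarrow>LG. qsum f (lsq n (y G)))"
      by (simp add: qsum_concat ys_def o_def)
    also have "\<dots> = (\<Sum>G\<in>Pow ?P. qsum f (lsq n (y G)))"
      using LG by (simp add: sum_list_distinct_conv_sum_set)
    also have "\<dots> = (\<Sum>G\<in>Pow ?P. qsum (tinj n G) x * mobius ?P f G + \<delta> * mobius ?P f G)"
      using sq by (intro sum.cong refl) (simp add: c_def algebra_simps)
    also have "\<dots> = (\<Sum>G\<in>Pow ?P. qsum (tinj n G) x * mobius ?P f G) + \<delta> * f {}"
      by (simp add: sum.distrib sum_mobius flip: sum_distrib_left)
    also have "(\<Sum>G\<in>Pow ?P. qsum (tinj n G) x * mobius ?P f G) = qsum f x"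
      using m(2) n(1) by (intro qsum_eq_sum_tinj[symmetric] that x) (auto intro: order_trans)
    finally show ?thesis .
  qed
  have "qnorm1 (qminus x ?s) \<le> \<delta>"
  proof (rule qnorm1_le_of_empty_graph_only)
    fix C assume "C \<in> qclasses (qminus x ?s)"
    \<comment> \<open>Membership in a class is an invariant parameter, so \<open>s\<close> yields
      every coefficient of the difference.\<close>
    then have "iso_inv (\<lambda>F. of_bool (F \<in> C))"
      unfolding iso_inv_def qclasses_def by (auto intro: giso_trans giso_sym)
    from s[OF this] show "\<bar>qcoef (qminus x ?s) C\<bar> = \<delta> * of_bool ({} \<in> C)"
      using \<open>\<delta> > 0\<close> by (simp add: qcoef_eq_qsum qsum_qminus)
  qed (use \<open>\<delta> > 0\<close> in simp)
  then show ?thesis using n1 wf by blast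
qed

theorem theorem4p1:
  fixes x :: qgraph
  assumes "wf_qgraph x"
  shows "qnonneg x \<longleftrightarrow>
    (\<forall>\<epsilon>>0. \<exists>k\<ge>1. \<exists>ys. (\<forall>y\<in>set ys. wf_qgraph y) \<and>
        qnorm1 (qminus x (concat (map (lsq k) ys))) < \<epsilon>)"
proof
  assume nn: "qnonneg x"
  show "\<forall>\<epsilon>>0. \<exists>k\<ge>1. \<exists>ys. (\<forall>y\<in>set ys. wf_qgraph y) \<and>
        qnorm1 (qminus x (concat (map (lsq k) ys))) < \<epsilon>"
  proof (intro allI impI)
    fix \<epsilon> :: real assume "\<epsilon> > 0"
    \<comment> \<open>Halving turns the weak bound of \<open>approx_of_qnonneg\<close> into a strict
      one.\<close>
    then have "\<epsilon> / 2 > 0" "\<epsilon> / 2 < \<epsilon>" by auto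
    then show "\<exists>k\<ge>1. \<exists>ys. (\<forall>y\<in>set ys. wf_qgraph y) \<and>
        qnorm1 (qminus x (concat (map (lsq k) ys))) < \<epsilon>"
      using approx_of_qnonneg[OF assms nn] by (meson le_less_trans)
  qed
next
  assume "\<forall>\<epsilon>>0. \<exists>k\<ge>1. \<exists>ys. (\<forall>y\<in>set ys. wf_qgraph y) \<and>
        qnorm1 (qminus x (concat (map (lsq k) ys))) < \<epsilon>"
  then show "qnonneg x" by (intro qnonneg_of_approx[OF assms]) blast
qed

end
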